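(* Let $n$ be a positive integer. The curve $\lambda\mapsto\lambda\mathbb{Z}^n$, $\lambda\in(0,\infty)$, is not continuous with respect to the Gromov--Hausdorff distance. In particular, it is not a geodesic in the Gromov--Hausdorff class.
   Context: $\mathbb{Z}^n\subset\mathbb{R}^n$ carries the metric induced from the Euclidean metric of $\mathbb{R}^n$. For a metric space $(X,d_X)$ and $\lambda>0$, $\lambda X$ denotes the metric space $(X,\lambda d_X)$. For metric spaces $X,Y$, $d_{GH}(X,Y)\in[0,\infty]$ is the Gromov--Hausdorff distance: the infimum of the numbers $r\ge 0$ such that there exist a metric space $Z$ and subsets $X',Y'\subset Z$ isometric to $X$ and $Y$ respectively with Hausdorff distance $d_H(X',Y')\le r$ (it may be infinite). The Gromov--Hausdorff class is the class of all non-empty metric spaces, considered up to zero Gromov--Hausdorff distance and equipped with $d_{GH}$. A curve $\gamma(\lambda)$, $\lambda\in(0,\infty)$, of metric spaces is continuous if $d_{GH}(\gamma(\lambda),\gamma(\lambda_0))\to0$ as $\lambda\to\lambda_0$ for every $\lambda_0>0$. It is a geodesic if there is a constant $C\in[0,\infty)$ with $d_{GH}(\gamma(s),\gamma(t))=C|s-t|$ for all $s,t$ in the parameter interval. *)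

theory Defs
  imports "HOL-Analysis.Analysis"
begin

definition isometric :: "'a metric \<Rightarrow> 'b metric \<Rightarrow> bool" where
  "isometric X Y \<longleftrightarrow>
    (\<exists>f. bij_betw f (mspace X) (mspace Y) \<and>
         (\<forall>x\<in>mspace X. \<forall>y\<in>mspace X. mdist Y (f x) (f y) = mdist X x y))"

definition hausdorff_dist :: "'a metric \<Rightarrow> 'a set \<Rightarrow> 'a set \<Rightarrow> ennreal" where
  "hausdorff_dist Z A B =
    max (SUP a\<in>A. INF b\<in>B. ennreal (mdist Z a b))
        (SUP b\<in>B. INF a\<in>A. ennreal (mdist Z a b))"

text \<open>
  A realization of \<open>X\<close> and \<open>Y\<close> inside \<open>Z\<close> with Hausdorff distance at most \<open>r\<close>.
  The carrier type of \<open>Z\<close> is arbitrary.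
\<close>

definition gh_realization ::
    "'a metric \<Rightarrow> 'b metric \<Rightarrow> 'c metric \<Rightarrow> 'c set \<Rightarrow> 'c set \<Rightarrow> real \<Rightarrow> bool" where
  "gh_realization X Y Z X' Y' r \<longleftrightarrow>
    X' \<subseteq> mspace Z \<and> Y' \<subseteq> mspace Z \<and>
    isometric X (submetric Z X') \<and> isometric Y (submetric Z Y') \<and>
    hausdorff_dist Z X' Y' \<le> ennreal r"

text \<open>
  The ambient space \<open>Z\<close> should range over all metric spaces, but HOL cannot quantify
  over types inside a definition. It is enough to let \<open>Z\<close> range over the metric
  spaces with carrier in the sum type: any \<open>Z\<close> may be cut down to \<open>X' \<union> Y'\<close>, which
  injects into that type. This is lemma \<open>gh_dist_le\<close> below.
\<close>

definition gh_dist :: "'a metric \<Rightarrow> 'b metric \<Rightarrow> ennreal" where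
  "gh_dist X Y =
    Inf {ennreal r | r. 0 \<le> r \<and>
          (\<exists>(Z :: ('a + 'b) metric) X' Y'. gh_realization X Y Z X' Y' r)}"

lemma gh_dist_le:
  fixes X :: "'a metric" and Y :: "'b metric" and Z :: "'c metric"
  assumes "0 \<le> r" and R: "gh_realization X Y Z X' Y' r"
  shows "gh_dist X Y \<le> ennreal r"
proof -
  obtain f g where XY: "X' \<subseteq> mspace Z" "Y' \<subseteq> mspace Z"
    and f: "bij_betw f (mspace X) X'" "\<forall>x\<in>mspace X. \<forall>y\<in>mspace X. mdist Z (f x) (f y) = mdist X x y"
    and g: "bij_betw g (mspace Y) Y'" "\<forall>x\<in>mspace Y. \<forall>y\<in>mspace Y. mdist Z (g x) (g y) = mdist Y x y"
    and H: "hausdorff_dist Z X' Y' \<le> ennreal r"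
    using R unfolding gh_realization_def isometric_def
    by (auto simp: Int_absorb2)
  define \<phi> :: "'c \<Rightarrow> 'a + 'b" where
    "\<phi> z = (if z \<in> X' then Inl (inv_into (mspace X) f z) else Inr (inv_into (mspace Y) g z))" for z
  have inj: "inj_on \<phi> (X' \<union> Y')"
    using f(1) g(1) unfolding inj_on_def \<phi>_def
    by (auto simp: bij_betw_def intro: inv_into_injective)
  define \<psi> where "\<psi> = inv_into (X' \<union> Y') \<phi>"
  have \<psi>: "\<psi> (\<phi> z) = z" if "z \<in> X' \<union> Y'" for z
    using inj that unfolding \<psi>_def by (rule inv_into_f_f)
  define W where "W = metric (\<phi> ` (X' \<union> Y'), \<lambda>u v. mdist Z (\<psi> u) (\<psi> v))"
  have "Metric_space (\<phi> ` (X' \<union> Y')) (\<lambda>u v. mdist Z (\<psi> u) (\<psi> v))"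
  proof
    fix u v w
    show "0 \<le> mdist Z (\<psi> u) (\<psi> v)" by simp
    show "mdist Z (\<psi> u) (\<psi> v) = mdist Z (\<psi> v) (\<psi> u)" by (rule mdist_commute)
    show "(mdist Z (\<psi> u) (\<psi> v) = 0) = (u = v)"
      if uv: "u \<in> \<phi> ` (X' \<union> Y')" "v \<in> \<phi> ` (X' \<union> Y')"
    proof -
      obtain a b where ab: "a \<in> X' \<union> Y'" "b \<in> X' \<union> Y'" "u = \<phi> a" "v = \<phi> b"
        using uv by blast
      then have "a \<in> mspace Z" "b \<in> mspace Z" using XY by auto
      then have "(mdist Z a b = 0) = (a = b)" by simp
      then show ?thesis using ab \<psi> inj by (metis inj_onD)
    qed
    show "mdist Z (\<psi> u) (\<psi> w) \<le> mdist Z (\<psi> u) (\<psi> v) + mdist Z (\<psi> v) (\<psi> w)"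
      if "u \<in> \<phi> ` (X' \<union> Y')" "v \<in> \<phi> ` (X' \<union> Y')" "w \<in> \<phi> ` (X' \<union> Y')"
      using that \<psi> XY by (intro mdist_triangle) auto
  qed
  then have W: "mspace W = \<phi> ` (X' \<union> Y')" "mdist W = (\<lambda>u v. mdist Z (\<psi> u) (\<psi> v))"
    by (simp_all add: W_def Metric_space.mspace_metric Metric_space.mdist_metric)
  have "isometric X (submetric W (\<phi> ` X'))"
    unfolding isometric_def
  proof (intro exI conjI ballI)
    show "bij_betw (\<phi> \<circ> f) (mspace X) (mspace (submetric W (\<phi> ` X')))"
      using f(1) inj W by (auto simp: Int_absorb2 bij_betw_def inj_on_def image_Un)
    show "mdist (submetric W (\<phi> ` X')) ((\<phi> \<circ> f) x) ((\<phi> \<circ> f) y) = mdist X x y"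
      if "x \<in> mspace X" "y \<in> mspace X" for x y
      using that f W \<psi> by (auto simp: bij_betw_def)
  qed
  moreover have "isometric Y (submetric W (\<phi> ` Y'))"
    unfolding isometric_def
  proof (intro exI conjI ballI)
    show "bij_betw (\<phi> \<circ> g) (mspace Y) (mspace (submetric W (\<phi> ` Y')))"
      using g(1) inj W by (auto simp: Int_absorb2 bij_betw_def inj_on_def image_Un)
    show "mdist (submetric W (\<phi> ` Y')) ((\<phi> \<circ> g) x) ((\<phi> \<circ> g) y) = mdist Y x y"
      if "x \<in> mspace Y" "y \<in> mspace Y" for x y
      using that g W \<psi> by (auto simp: bij_betw_def)
  qed
  moreover have "hausdorff_dist W (\<phi> ` X') (\<phi> ` Y') = hausdorff_dist Z X' Y'"
    unfolding hausdorff_dist_def W image_image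
    by (intro arg_cong2[of _ _ _ _ max] SUP_cong INF_cong refl) (simp_all add: \<psi>)
  ultimately have "gh_realization X Y W (\<phi> ` X') (\<phi> ` Y') r"
    using H by (auto simp: gh_realization_def W)
  then show ?thesis
    unfolding gh_dist_def using \<open>0 \<le> r\<close> by (intro Inf_lower) blast
qed

text \<open>
  Curves are given by representatives: the notions below depend on \<open>\<gamma> t\<close> only up to
  zero Gromov--Hausdorff distance.
\<close>

definition gh_continuous_on :: "real set \<Rightarrow> (real \<Rightarrow> 'a metric) \<Rightarrow> bool" where
  "gh_continuous_on I \<gamma> \<longleftrightarrow>
    (\<forall>t\<^sub>0\<in>I. ((\<lambda>t. gh_dist (\<gamma> t) (\<gamma> t\<^sub>0)) \<longlongrightarrow> 0) (at t\<^sub>0 within I))"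

definition gh_geodesic_on :: "real set \<Rightarrow> (real \<Rightarrow> 'a metric) \<Rightarrow> bool" where
  "gh_geodesic_on I \<gamma> \<longleftrightarrow>
    (\<exists>C\<ge>0. \<forall>s\<in>I. \<forall>t\<in>I. gh_dist (\<gamma> s) (\<gamma> t) = ennreal (C * \<bar>s - t\<bar>))"

text \<open>Meaningful for \<open>c > 0\<close> only.\<close>

definition scale_metric :: "real \<Rightarrow> 'a metric \<Rightarrow> 'a metric" where
  "scale_metric c X = metric (mspace X, \<lambda>x y. c * mdist X x y)"

lemma
  assumes "c > 0"
  shows mspace_scale_metric [simp]: "mspace (scale_metric c X) = mspace X"
    and mdist_scale_metric [simp]: "mdist (scale_metric c X) x y = c * mdist X x y"
proof -
  have "Metric_space (mspace X) (\<lambda>x y. c * mdist X x y)"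
  proof
    fix x y z
    assume "x \<in> mspace X" "y \<in> mspace X" "z \<in> mspace X"
    then show "c * mdist X x z \<le> c * mdist X x y + c * mdist X y z"
      using assms mdist_triangle[of x X y z] by (simp flip: distrib_left)
  qed (use assms in \<open>simp_all add: mdist_commute\<close>)
  then show "mspace (scale_metric c X) = mspace X"
    and "mdist (scale_metric c X) x y = c * mdist X x y"
    by (simp_all add: scale_metric_def Metric_space.mspace_metric Metric_space.mdist_metric)
qed

definition int_lattice :: "(real ^ 'n) metric" where
  "int_lattice = submetric euclidean_metric {x. \<forall>i. x $ i \<in> \<int>}"

lemma mspace_int_lattice [simp]: "mspace int_lattice = {x. \<forall>i. x $ i \<in> \<int>}"
  and mdist_int_lattice [simp]: "mdist int_lattice = dist"
  by (simp_all add: int_lattice_def)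

lemma mspace_int_lattice_nonempty: "mspace int_lattice \<noteq> {}"
  by (auto intro: exI[of _ 0])

end

theory Submission
  imports Defs
begin

text \<open>
  The curve jumps at \<open>\<lambda> = 1\<close>: for \<open>t\<close> slightly larger than \<open>1\<close>, the spaces \<open>t\<int>\<^sup>n\<close> and
  \<open>\<int>\<^sup>n\<close> stay at distance at least \<open>1/10\<close>. The point is that distances in the lattice are
  quantized, so that a small additive error in the length of a step has to be rounded down,
  and this loss accumulates over many steps. Indeed, if the distance were smaller, there would be a map \<open>g\<close> from \<open>t\<int>\<^sup>n\<close> to \<open>\<int>\<^sup>n\<close>
  changing all distances by less than \<open>1/5\<close> (\<open>gh_dist_less_imp_map\<close>). Two neighbours in
  \<open>t\<int>\<^sup>n\<close>, which have distance \<open>t\<close>, go to points of distance less than \<open>\<surd>2\<close>, hence at most \<open>1\<close>,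
  since squared distances in \<open>\<int>\<^sup>n\<close> are integers (\<open>lattice_dist_le_1\<close>). Walking \<open>k\<close> steps
  along a coordinate axis, the end points of the image are at most \<open>k\<close> apart, whereas the
  end points of the walk are \<open>t k\<close> apart. The difference \<open>(t - 1) k\<close> is unbounded in \<open>k\<close>,
  which contradicts the bound \<open>1/5\<close>.

  A geodesic is Lipschitz, hence continuous, so the curve is not a geodesic either.
\<close>

text \<open>
  Inside a common ambient space, send each point of the copy of \<open>X\<close> to a point of the copy of
  \<open>Y\<close> closer than \<open>r\<close>. Moving both end points of a pair changes its distance by less than \<open>2 r\<close>.
\<close>

lemma gh_dist_less_imp_map:
  fixes X :: "'a metric" and Y :: "'b metric"
  assumes "gh_dist X Y < ennreal r"
  obtains g where "\<And>x. x \<in> mspace X \<Longrightarrow> g x \<in> mspace Y"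
    and "\<And>x y. x \<in> mspace X \<Longrightarrow> y \<in> mspace X \<Longrightarrow> \<bar>mdist Y (g x) (g y) - mdist X x y\<bar> < 2 * r"
proof -
  obtain r' X' Y' and Z :: "('a + 'b) metric"
    where r': "ennreal r' < ennreal r" and R: "gh_realization X Y Z X' Y' r'"
    using assms unfolding gh_dist_def Inf_less_iff by blast
  obtain \<phi> \<psi> where sub: "X' \<subseteq> mspace Z" "Y' \<subseteq> mspace Z"
    and \<phi>: "bij_betw \<phi> (mspace X) X'"
      "\<And>x y. x \<in> mspace X \<Longrightarrow> y \<in> mspace X \<Longrightarrow> mdist Z (\<phi> x) (\<phi> y) = mdist X x y"
    and \<psi>: "bij_betw \<psi> (mspace Y) Y'"
      "\<And>x y. x \<in> mspace Y \<Longrightarrow> y \<in> mspace Y \<Longrightarrow> mdist Z (\<psi> x) (\<psi> y) = mdist Y x y"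
    and H: "hausdorff_dist Z X' Y' \<le> ennreal r'"
    using R unfolding gh_realization_def isometric_def
    by (auto simp: Int_absorb2)
  have "\<exists>y\<in>mspace Y. mdist Z (\<phi> x) (\<psi> y) < r" if x: "x \<in> mspace X" for x
  proof -
    have "(INF b\<in>Y'. ennreal (mdist Z (\<phi> x) b)) \<le> (SUP a\<in>X'. INF b\<in>Y'. ennreal (mdist Z a b))"
      using x \<phi>(1) by (intro SUP_upper) (auto simp: bij_betw_def)
    also have "\<dots> \<le> hausdorff_dist Z X' Y'"
      by (simp add: hausdorff_dist_def)
    also have "\<dots> < ennreal r"
      using H r' by (rule le_less_trans)
    finally obtain b where "b \<in> Y'" "ennreal (mdist Z (\<phi> x) b) < ennreal r"
      by (auto simp: INF_less_iff)
    then show ?thesis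
      using \<psi>(1) by (auto simp: bij_betw_def ennreal_less_iff)
  qed
  then obtain g where g: "\<And>x. x \<in> mspace X \<Longrightarrow> g x \<in> mspace Y"
    "\<And>x. x \<in> mspace X \<Longrightarrow> mdist Z (\<phi> x) (\<psi> (g x)) < r"
    by metis
  show ?thesis
  proof (rule that[of g])
    show "g x \<in> mspace Y" if "x \<in> mspace X" for x
      using g(1) that .
    fix x y assume xy: "x \<in> mspace X" "y \<in> mspace X"
    have in_Z: "\<phi> u \<in> mspace Z" "\<psi> (g u) \<in> mspace Z" if "u \<in> mspace X" for u
      using that sub \<phi>(1) \<psi>(1) g(1) by (auto simp: bij_betw_def)
    have "mdist Z (\<psi> (g x)) (\<psi> (g y)) \<le> mdist Z (\<phi> x) (\<psi> (g x)) + mdist Z (\<phi> x) (\<phi> y) + mdist Z (\<phi> y) (\<psi> (g y))"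
      using mdist_triangle[of "\<psi> (g x)" Z "\<phi> x" "\<psi> (g y)"] mdist_triangle[of "\<phi> x" Z "\<phi> y" "\<psi> (g y)"]
        in_Z xy by (simp add: mdist_commute)
    moreover have "mdist Z (\<phi> x) (\<phi> y) \<le> mdist Z (\<phi> x) (\<psi> (g x)) + mdist Z (\<psi> (g x)) (\<psi> (g y)) + mdist Z (\<phi> y) (\<psi> (g y))"
      using mdist_triangle[of "\<phi> x" Z "\<psi> (g x)" "\<phi> y"] mdist_triangle[of "\<psi> (g x)" Z "\<psi> (g y)" "\<phi> y"]
        in_Z xy by (simp add: mdist_commute)
    ultimately show "\<bar>mdist Y (g x) (g y) - mdist X x y\<bar> < 2 * r"
      using g(2)[OF xy(1)] g(2)[OF xy(2)] \<phi>(2)[OF xy] \<psi>(2)[OF g(1)[OF xy(1)] g(1)[OF xy(2)]]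
      by linarith
  qed
qed

text \<open>
  Squared distances in the lattice are integers, so a squared distance below \<open>2\<close> is at most \<open>1\<close>.
\<close>

lemma lattice_dist_le_1:
  fixes x y :: "real ^ 'n"
  assumes "x \<in> mspace int_lattice" "y \<in> mspace int_lattice" "(dist x y)\<^sup>2 < 2"
  shows "dist x y \<le> 1"
proof -
  have "(dist x y)\<^sup>2 = (\<Sum>i\<in>UNIV. (x $ i - y $ i)\<^sup>2)"
    by (simp add: dist_vec_def L2_set_def sum_nonneg dist_real_def)
  also have "\<dots> \<in> \<int>"
    using assms(1,2) by (intro Ints_sum Ints_power Ints_diff) auto
  finally obtain m :: int where m: "(dist x y)\<^sup>2 = of_int m"
    by (auto elim: Ints_cases)
  then have "m < 2"
    using assms(3) by simp
  then have "(dist x y)\<^sup>2 \<le> 1\<^sup>2"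
    using m by simp
  then show ?thesis
    by (rule power2_le_imp_le) simp
qed

lemma dist_chain_le:
  fixes h :: "nat \<Rightarrow> 'a::metric_space"
  assumes "\<And>k. dist (h (Suc k)) (h k) \<le> c"
  shows "dist (h k) (h 0) \<le> real k * c"
proof (induction k)
  case (Suc k)
  have "dist (h (Suc k)) (h 0) \<le> dist (h (Suc k)) (h k) + dist (h k) (h 0)"
    by (rule dist_triangle)
  also have "\<dots> \<le> c + real k * c"
    using assms[of k] Suc by linarith
  finally show ?case
    by (simp add: algebra_simps)
qed simp

text \<open>
  The constants are chosen so that a step of length \<open>t\<close> together with the error stays below
  \<open>11/10 + 2/10 < \<surd>2\<close>.
\<close>

lemma gh_dist_scaled_lattice_ge:
  assumes t: "1 < t" "t \<le> 11/10"
  shows "gh_dist (scale_metric t (int_lattice :: (real ^ 'n) metric))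
           (scale_metric 1 (int_lattice :: (real ^ 'n) metric)) \<ge> ennreal (1/10)"
proof (rule ccontr)
  let ?L = "int_lattice :: (real ^ 'n) metric"
  assume "\<not> ?thesis"
  then have "gh_dist (scale_metric t ?L) (scale_metric 1 ?L) < ennreal (1/10)"
    by (simp add: not_le)
  then obtain g where g: "\<And>x. x \<in> mspace ?L \<Longrightarrow> g x \<in> mspace ?L"
    and "\<And>x y. x \<in> mspace ?L \<Longrightarrow> y \<in> mspace ?L \<Longrightarrow>
      \<bar>mdist (scale_metric 1 ?L) (g x) (g y) - mdist (scale_metric t ?L) x y\<bar> < 2 * (1/10)"
    using t by (elim gh_dist_less_imp_map) (auto simp del: mspace_int_lattice)
  then have d: "\<bar>dist (g x) (g y) - t * dist x y\<bar> < 1/5" if "x \<in> mspace ?L" "y \<in> mspace ?L" for x y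
    using that t by (fastforce simp del: mspace_int_lattice)
  \<comment> \<open>Any coordinate axis will do; \<open>undefined\<close> picks one index of the non-empty type.\<close>
  define e :: "nat \<Rightarrow> real ^ 'n" where "e k = axis undefined (real k)" for k
  have e_in: "e k \<in> mspace ?L" for k
    by (auto simp: e_def axis_def)
  have dist_e: "dist (e j) (e k) = \<bar>real j - real k\<bar>" for j k
  proof -
    have "e j - e k = axis undefined (real j - real k)"
      by (simp add: e_def vec_eq_iff axis_def)
    then show ?thesis
      by (simp add: dist_norm norm_eq_sqrt_inner inner_axis_axis)
  qed
  have step: "dist (g (e (Suc k))) (g (e k)) \<le> 1" for k
  proof (rule lattice_dist_le_1)
    have "\<bar>dist (g (e (Suc k))) (g (e k)) - t\<bar> < 1/5"
      using d[OF e_in[of "Suc k"] e_in[of k]] by (simp add: dist_e)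
    then have "dist (g (e (Suc k))) (g (e k)) < 13/10"
      using t by linarith
    then have "(dist (g (e (Suc k))) (g (e k)))\<^sup>2 \<le> (13/10)\<^sup>2"
      by (intro power_mono) auto
    then show "(dist (g (e (Suc k))) (g (e k)))\<^sup>2 < 2"
      by (simp add: power2_eq_square)
  qed (use g e_in in blast)+
  obtain k where k: "1/5 < real k * (t - 1)"
    using reals_Archimedean3[of "t - 1"] t by (meson diff_gt_0_iff_gt)
  have "dist (g (e k)) (g (e 0)) \<le> real k * 1"
    using dist_chain_le[of "\<lambda>k. g (e k)", OF step] .
  moreover have "\<bar>dist (g (e k)) (g (e 0)) - t * real k\<bar> < 1/5"
    using d[OF e_in[of k] e_in[of 0]] by (simp add: dist_e)
  ultimately show False
    using k unfolding right_diff_distrib mult.commute[of t] by linarith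
qed

lemma gh_geodesic_imp_continuous:
  assumes "gh_geodesic_on I \<gamma>"
  shows "gh_continuous_on I \<gamma>"
  unfolding gh_continuous_on_def
proof
  fix t\<^sub>0 assume t0: "t\<^sub>0 \<in> I"
  obtain C where C: "\<forall>s\<in>I. \<forall>t\<in>I. gh_dist (\<gamma> s) (\<gamma> t) = ennreal (C * \<bar>s - t\<bar>)"
    using assms by (auto simp: gh_geodesic_on_def)
  have "((\<lambda>t. C * \<bar>t - t\<^sub>0\<bar>) \<longlongrightarrow> C * \<bar>t\<^sub>0 - t\<^sub>0\<bar>) (at t\<^sub>0 within I)"
    by (intro tendsto_intros)
  then have "((\<lambda>t. ennreal (C * \<bar>t - t\<^sub>0\<bar>)) \<longlongrightarrow> 0) (at t\<^sub>0 within I)"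
    using tendsto_ennrealI by fastforce
  then show "((\<lambda>t. gh_dist (\<gamma> t) (\<gamma> t\<^sub>0)) \<longlongrightarrow> 0) (at t\<^sub>0 within I)"
    by (rule Lim_transform_eventually) (use C t0 in \<open>auto simp: eventually_at_filter\<close>)
qed

theorem corollary5:
  shows "\<not> gh_continuous_on {0<..} (\<lambda>c. scale_metric c (int_lattice :: (real ^ 'n) metric)) \<and>
         \<not> gh_geodesic_on {0<..} (\<lambda>c. scale_metric c (int_lattice :: (real ^ 'n) metric))"
proof -
  let ?\<gamma> = "\<lambda>c. scale_metric c (int_lattice :: (real ^ 'n) metric)"
  have "\<not> gh_continuous_on {0<..} ?\<gamma>"
  proof
    assume "gh_continuous_on {0<..} ?\<gamma>"
    then have "((\<lambda>t. gh_dist (?\<gamma> t) (?\<gamma> 1)) \<longlongrightarrow> 0) (at 1 within {0<..})"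
      by (auto simp: gh_continuous_on_def)
    then have "((\<lambda>t. gh_dist (?\<gamma> t) (?\<gamma> 1)) \<longlongrightarrow> 0) (at_right 1)"
      by (rule tendsto_within_subset) auto
    then have "\<forall>\<^sub>F t in at_right 1. gh_dist (?\<gamma> t) (?\<gamma> 1) < ennreal (1/10)"
      by (rule order_tendstoD) simp
    moreover have "\<forall>\<^sub>F t in at_right (1::real). t \<in> {1<..<11/10}"
      by (rule eventually_at_right_real) simp
    ultimately have "\<forall>\<^sub>F t in at_right (1::real). False"
      by eventually_elim (use gh_dist_scaled_lattice_ge in \<open>force simp: not_le[symmetric]\<close>)
    then show False
      by simp
  qed
  then show ?thesis
    using gh_geodesic_imp_continuous by blast
qed

end
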